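(* Let $(\Omega,\mathcal{B},\mathbb{P})$ be a probability space, let $p>1$, let $\varphi$ be a positive function in $L^p(\Omega)$ and let $\varepsilon>0$. Then there exist constants $C_n=C_n(p,\varepsilon,\varphi)$, $n\ge1$, depending only on $p$, $\varepsilon$ and $\varphi$, with $$\sum_{n\ge1}n^{p-2}C_n<\infty,$$ such that the following holds. Let $\mathcal{B}_0\subset\cdots\subset\mathcal{B}_n\subset\cdots$ be sub-$\sigma$-algebras of $\mathcal{B}$, let $(\varphi_n)_{n\ge1}$ be a martingale difference with respect to $(\mathcal{B}_n)_{n\ge 0}$, and let $S_n:=\varphi_1+\cdots+\varphi_n$ be the corresponding martingale. Assume that, for all $n\ge1$ and $t>0$, $$\mathbb{E}(\mathbf{1}_{\{|\varphi_n|>t\}}\mid\mathcal{B}_{n-1})\le\mathbb{P}(\{\varphi>t\})\quad\text{almost surely}.$$ Then, for all $n\ge1$, $$\mathbb{P}(|S_n|>n\varepsilon)\le C_n .$$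
   Context: A martingale difference with respect to $(\mathcal{B}_n)_{n\ge0}$ is a sequence $(\varphi_n)_{n\ge1}$ of integrable real random variables on $\Omega$ such that $\varphi_n$ is $\mathcal{B}_n$-measurable and $\mathbb{E}(\varphi_n\mid\mathcal{B}_{n-1})=0$ for all $n\ge1$. *)

theory Defs
  imports "HOL-Probability.Probability"
begin

(* The sigma-algebras B n are encoded as measures of which only the space and the measurable
   sets matter: real_cond_exp M (B n) always refers to the restriction of M to sets (B n). *)
definition sub_sigma_filtration :: "'a measure \<Rightarrow> (nat \<Rightarrow> 'a measure) \<Rightarrow> bool" where
  "sub_sigma_filtration M B \<longleftrightarrow> (\<forall>n. subalgebra M (B n)) \<and> filtration (space M) B"

(* Sequences are indexed from 1; the value X 0 is irrelevant. *)
definition martingale_difference ::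
    "'a measure \<Rightarrow> (nat \<Rightarrow> 'a measure) \<Rightarrow> (nat \<Rightarrow> 'a \<Rightarrow> real) \<Rightarrow> bool" where
  "martingale_difference M B X \<longleftrightarrow>
    (\<forall>n\<ge>1. integrable M (X n) \<and> X n \<in> borel_measurable (B n) \<and>
            (AE x in M. real_cond_exp M (B (n - 1)) (X n) x = 0))"

definition in_Lp :: "'a measure \<Rightarrow> real \<Rightarrow> ('a \<Rightarrow> real) \<Rightarrow> bool" where
  "in_Lp M p f \<longleftrightarrow> f \<in> borel_measurable M \<and> integrable M (\<lambda>x. \<bar>f x\<bar> powr p)"

end

theory Submission
  imports Defs "HOL-Real_Asymp.Real_Asymp"
begin

text \<open>
  The estimate combines a union bound for large increments with an exponential Chernoff bound
  for the rest, and only one moment of \<open>\<phi>\<close> of order \<open>r \<in> (1, 2]\<close>, \<open>r \<le> p\<close>, enters the second part.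
  Fix \<open>n\<close> and truncate the increments at the level \<open>c = \<delta> n\<close>.

  Some increment among the first \<open>n\<close> exceeds \<open>c\<close> with probability at most
  \<open>n P(\<phi> > \<delta> n)\<close>. Weighted with \<open>n powr (p - 2)\<close> this is summable because \<open>\<phi>\<close> has a finite moment
  of order \<open>p\<close> (\<open>summable_powr_tail\<close>).

  For the truncated increments, the pointwise bound \<open>exp_truncation_le\<close> compares the exponential
  \<open>exp (l * truncation c x)\<close> with \<open>1 + l x + K \<bar>x\<bar> powr r\<close>. The linear term contains the original
  increment and not the truncated one, so it vanishes under conditional expectation although
  the truncated increments are not centred. The last term is controlled since conditional domination of tails gives
  conditional domination of moments, by integrating the tails (\<open>weighted_moment_le\<close>). Hence every
  further increment multiplies the exponential moment of the truncated sum by at most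
  \<open>1 + K E(\<bar>\<phi>\<bar> powr r)\<close>.

  With \<open>l = a ln n / n\<close> and \<open>a \<delta> = (r - 1) / 2\<close>, the factor \<open>exp (l c)\<close> inside \<open>K\<close> is only
  \<open>n powr ((r - 1) / 2)\<close>, which is beaten by \<open>l powr (r - 1)\<close>. So \<open>K\<close> is \<open>o(l)\<close>
  (\<open>eventually_exp_excess_le\<close>), and Markov's inequality bounds the probability that the truncated
  sum exceeds \<open>n \<epsilon>\<close> by \<open>exp (- n l \<epsilon> / 2) = n powr (- a \<epsilon> / 2)\<close>. The choice \<open>a = 2 p / \<epsilon>\<close>
  makes this \<open>n powr (- p)\<close>, whose weighted series is that of \<open>n powr (- 2)\<close>.
\<close>

section \<open>A pointwise exponential bound for truncated numbers\<close>

text \<open>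
  Near zero the error of the linear approximation is quadratic and \<open>y\<^sup>2 \<le> \<bar>y\<bar> powr r\<close>; far from zero
  \<open>\<bar>y\<bar> powr r\<close> is at least both \<open>1\<close> and \<open>\<bar>y\<bar>\<close>. The first regime
  needs \<open>r \<le> 2\<close>, the second \<open>r \<ge> 1\<close>.
\<close>

lemma exp_le_linear_plus_powr:
  fixes y r :: real
  assumes "1 < r" "r \<le> 2"
  shows "exp y \<le> 1 + y + \<bar>y\<bar> powr r * exp \<bar>y\<bar>"
proof (cases "\<bar>y\<bar> \<le> 1")
  case True
  have "exp y \<le> 1 + y + y\<^sup>2"
  proof (cases "0 \<le> y")
    case True
    with \<open>\<bar>y\<bar> \<le> 1\<close> show ?thesis by (intro exp_bound) auto
  next
    case False
    have "1 \<le> (1 - y) * (1 + y + y\<^sup>2)"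
    proof -
      have "(1 - y) * (1 + y + y\<^sup>2) = 1 + (- y) ^ 3"
        by (simp add: algebra_simps power2_eq_square power3_eq_cube)
      with False show ?thesis by simp
    qed
    also have "\<dots> \<le> exp (- y) * (1 + y + y\<^sup>2)"
      using exp_ge_add_one_self[of "- y"] \<open>\<bar>y\<bar> \<le> 1\<close>
      by (intro mult_right_mono) auto
    finally show ?thesis by (simp add: exp_minus field_simps)
  qed
  moreover have "y\<^sup>2 \<le> \<bar>y\<bar> powr r"
  proof (cases "y = 0")
    case False
    have "y\<^sup>2 = \<bar>y\<bar> powr 2" using False by simp
    also have "\<dots> \<le> \<bar>y\<bar> powr r" using True assms False by (intro powr_mono') auto
    finally show ?thesis .
  qed simp
  moreover have "\<bar>y\<bar> powr r * 1 \<le> \<bar>y\<bar> powr r * exp \<bar>y\<bar>"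
    by (intro mult_left_mono) auto
  ultimately show ?thesis by simp
next
  case False
  have 1: "\<bar>y\<bar> powr 1 \<le> \<bar>y\<bar> powr r" using False assms by (intro powr_mono) auto
  show ?thesis
  proof (cases "0 \<le> y")
    case True
    have "1 * exp y \<le> \<bar>y\<bar> powr r * exp \<bar>y\<bar>"
      using 1 False True by (intro mult_mono) auto
    with True show ?thesis by linarith
  next
    case neg: False
    have "\<bar>y\<bar> * 1 \<le> \<bar>y\<bar> powr r * exp \<bar>y\<bar>"
      using 1 False by (intro mult_mono) auto
    moreover have "exp y \<le> 1" using neg by simp
    ultimately show ?thesis using neg by linarith
  qed
qed

definition truncation :: "real \<Rightarrow> real \<Rightarrow> real" where
  "truncation c x = (if \<bar>x\<bar> \<le> c then x else 0)"

lemma measurable_truncation [measurable]: "truncation c \<in> borel_measurable borel"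
  unfolding truncation_def by measurable

lemma abs_truncation_le: "0 \<le> c \<Longrightarrow> \<bar>truncation c x\<bar> \<le> c"
  by (simp add: truncation_def)

lemma truncation_minus: "truncation c (- x) = - truncation c x"
  by (simp add: truncation_def)

text \<open>The coefficient \<open>K\<close> of \<open>\<bar>x\<bar> powr r\<close> in the bound \<open>exp_truncation_le\<close>: its first summand pays for the
  linear term where \<open>x\<close> is cut off, its second one for the error of the linear approximation
  where it is not.\<close>

definition exp_excess :: "real \<Rightarrow> real \<Rightarrow> real \<Rightarrow> real" where
  "exp_excess r c l = l * c powr (1 - r) + l powr r * exp (l * c)"

text \<open>Beyond the level \<open>c\<close> the left side is \<open>1\<close>, and the possibly very negative \<open>l * x\<close> is compensated
  because \<open>\<bar>x\<bar> \<le> c powr (1 - r) * \<bar>x\<bar> powr r\<close> there. Keeping \<open>x\<close> itself in the linear term is what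
  later allows the martingale property to be used directly.\<close>

lemma exp_truncation_le:
  fixes x r c l :: real
  assumes "1 < r" "r \<le> 2" "0 < c" "0 \<le> l"
  shows "exp (l * truncation c x) \<le> 1 + l * x + exp_excess r c l * \<bar>x\<bar> powr r"
proof (cases "\<bar>x\<bar> \<le> c")
  case True
  have "exp (l * x) \<le> 1 + l * x + \<bar>l * x\<bar> powr r * exp \<bar>l * x\<bar>"
    by (rule exp_le_linear_plus_powr) fact+
  also have "\<bar>l * x\<bar> powr r * exp \<bar>l * x\<bar> \<le> l powr r * \<bar>x\<bar> powr r * exp (l * c)"
    using assms True by (auto simp: abs_mult powr_mult intro!: mult_left_mono)
  also have "\<dots> \<le> exp_excess r c l * \<bar>x\<bar> powr r"
    using assms by (simp add: exp_excess_def algebra_simps)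
  finally show ?thesis using True by (simp add: truncation_def)
next
  case False
  have "\<bar>x\<bar> = \<bar>x\<bar> powr (1 - r) * \<bar>x\<bar> powr r"
    using False assms by (simp flip: powr_add)
  also have "\<dots> \<le> c powr (1 - r) * \<bar>x\<bar> powr r"
    using False assms by (intro mult_right_mono powr_mono2') auto
  finally have "l * \<bar>x\<bar> \<le> l * (c powr (1 - r) * \<bar>x\<bar> powr r)"
    using assms by (intro mult_left_mono) auto
  also have "\<dots> \<le> exp_excess r c l * \<bar>x\<bar> powr r"
    by (simp add: exp_excess_def algebra_simps)
  finally have "l * \<bar>x\<bar> \<le> exp_excess r c l * \<bar>x\<bar> powr r" .
  moreover have "- (l * x) \<le> l * \<bar>x\<bar>"
    using mult_left_mono[of "- x" "\<bar>x\<bar>" l] assms by simp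
  ultimately show ?thesis using False by (simp add: truncation_def)
qed

section \<open>From tails to moments\<close>

text \<open>Fubini's theorem for the region under the graph of \<open>\<bar>u\<bar> powr r\<close>. The level \<open>s\<close> refers to that
  power, whence the root in the tail of \<open>u\<close>; strict inequalities match the tail bounds at hand.\<close>

lemma nn_integral_layer_cake_powr:
  fixes u :: "'a \<Rightarrow> real"
  assumes "sigma_finite_measure N" and [measurable]: "u \<in> borel_measurable N" and "0 < r"
  shows "(\<integral>\<^sup>+x. ennreal (\<bar>u x\<bar> powr r) \<partial>N) =
    (\<integral>\<^sup>+s. indicator {0<..} s * emeasure N {x \<in> space N. s powr (1 / r) < \<bar>u x\<bar>} \<partial>lborel)"
proof -
  interpret N: sigma_finite_measure N by fact
  interpret pair_sigma_finite N "lborel :: real measure" ..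
  have iff: "s powr (1 / r) < \<bar>u x\<bar> \<longleftrightarrow> s < \<bar>u x\<bar> powr r" if "0 < s" for s x
  proof -
    have "(s powr (1 / r)) powr r = s" using that \<open>0 < r\<close> by (simp add: powr_powr)
    then show ?thesis
      using powr_less_mono2[of r "s powr (1 / r)" "\<bar>u x\<bar>"]
        powr_mono2[of r "\<bar>u x\<bar>" "s powr (1 / r)"] \<open>0 < r\<close> by (fastforce simp: not_less)
  qed
  have "(\<integral>\<^sup>+x. ennreal (\<bar>u x\<bar> powr r) \<partial>N) =
    (\<integral>\<^sup>+x. (\<integral>\<^sup>+s. indicator {0<..<\<bar>u x\<bar> powr r} s \<partial>lborel) \<partial>N)"
    by (intro nn_integral_cong) simp
  also have "\<dots> = (\<integral>\<^sup>+x. (\<integral>\<^sup>+s. (if 0 < s \<and> s < \<bar>u x\<bar> powr r then 1 else 0) \<partial>lborel) \<partial>N)"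
    by (intro nn_integral_cong) (auto simp: indicator_def)
  also have "\<dots> = (\<integral>\<^sup>+s. (\<integral>\<^sup>+x. (if 0 < s \<and> s < \<bar>u x\<bar> powr r then 1 else 0) \<partial>N) \<partial>lborel)"
    by (rule Fubini'[symmetric]) measurable
  also have "\<dots> = (\<integral>\<^sup>+s. indicator {0<..} s * emeasure N {x \<in> space N. s powr (1 / r) < \<bar>u x\<bar>} \<partial>lborel)"
  proof (intro nn_integral_cong)
    fix s :: real
    have "(\<integral>\<^sup>+x. (if 0 < s \<and> s < \<bar>u x\<bar> powr r then 1 else 0) \<partial>N) =
      (\<integral>\<^sup>+x. indicator {0<..} s * indicator {x \<in> space N. s powr (1 / r) < \<bar>u x\<bar>} x \<partial>N)"
      by (intro nn_integral_cong) (auto simp: indicator_def iff)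
    also have "\<dots> = indicator {0<..} s * emeasure N {x \<in> space N. s powr (1 / r) < \<bar>u x\<bar>}"
      by (subst nn_integral_cmult) auto
    finally show "(\<integral>\<^sup>+x. (if 0 < s \<and> s < \<bar>u x\<bar> powr r then 1 else 0) \<partial>N) = \<dots>" .
  qed
  finally show ?thesis .
qed

text \<open>The two functions live on different measure spaces: \<open>N\<close> will be the underlying probability
  reweighted by a density, and \<open>K\<close> the total mass of that density.\<close>

lemma nn_integral_powr_mono_tails:
  fixes u :: "'a \<Rightarrow> real" and v :: "'b \<Rightarrow> real"
  assumes "sigma_finite_measure N" "u \<in> borel_measurable N"
    and "sigma_finite_measure M" and [measurable]: "v \<in> borel_measurable M" and "0 < r"
    and tails: "\<And>t. 0 < t \<Longrightarrow> emeasure N {x \<in> space N. t < \<bar>u x\<bar>}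
      \<le> K * emeasure M {x \<in> space M. t < \<bar>v x\<bar>}"
  shows "(\<integral>\<^sup>+x. ennreal (\<bar>u x\<bar> powr r) \<partial>N) \<le> K * (\<integral>\<^sup>+x. ennreal (\<bar>v x\<bar> powr r) \<partial>M)"
proof -
  interpret M: sigma_finite_measure M by fact
  have "(\<integral>\<^sup>+x. ennreal (\<bar>u x\<bar> powr r) \<partial>N) =
    (\<integral>\<^sup>+s. indicator {0<..} s * emeasure N {x \<in> space N. s powr (1 / r) < \<bar>u x\<bar>} \<partial>lborel)"
    by (rule nn_integral_layer_cake_powr) fact+
  also have "\<dots> \<le>
    (\<integral>\<^sup>+s. K * (indicator {0<..} s * emeasure M {x \<in> space M. s powr (1 / r) < \<bar>v x\<bar>}) \<partial>lborel)"
    using tails by (intro nn_integral_mono) (auto simp: indicator_def)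
  also have "\<dots> = K * (\<integral>\<^sup>+s. indicator {0<..} s * emeasure M {x \<in> space M. s powr (1 / r) < \<bar>v x\<bar>} \<partial>lborel)"
    by (intro nn_integral_cmult) measurable
  also have "\<dots> = K * (\<integral>\<^sup>+x. ennreal (\<bar>v x\<bar> powr r) \<partial>M)"
    by (subst nn_integral_layer_cake_powr) (use assms in auto)
  finally show ?thesis .
qed

section \<open>One increment under a predictable weight\<close>

context prob_space
begin

lemma sigma_finite_subalgebraI: "subalgebra M F \<Longrightarrow> sigma_finite_subalgebra M F"
  by (intro finite_measure_subalgebra_is_sigma_finite finite_measure_subalgebra.intro
      finite_measure_subalgebra_axioms.intro finite_measure_axioms)

text \<open>Conditional statements are used only in this integrated form, tested against bounded
  nonnegative \<open>F\<close>-measurable weights. This avoids the null sets of the conditional tail bounds,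
  which depend on \<open>t\<close>.\<close>

lemma weighted_tail_le:
  fixes X W :: "'a \<Rightarrow> real"
  assumes sub: "subalgebra M F" and [measurable]: "X \<in> borel_measurable M"
    and tail: "AE x in M. real_cond_exp M F (indicator {y \<in> space M. \<bar>X y\<bar> > t}) x \<le> q"
    and W [measurable]: "W \<in> borel_measurable F" and W_bd: "\<And>x. 0 \<le> W x" "\<And>x. W x \<le> K"
  shows "expectation (\<lambda>x. W x * indicator {y \<in> space M. \<bar>X y\<bar> > t} x) \<le> q * expectation W"
proof -
  interpret sigma_finite_subalgebra M F by (rule sigma_finite_subalgebraI[OF sub])
  have [measurable]: "W \<in> borel_measurable M" by (rule measurable_from_subalg[OF sub W])
  define I :: "'a \<Rightarrow> real" where "I = indicator {y \<in> space M. \<bar>X y\<bar> > t}"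
  have [measurable]: "I \<in> borel_measurable M" unfolding I_def by measurable
  have K: "0 \<le> K" using W_bd order_trans by blast
  have int: "integrable M W" "integrable M (\<lambda>x. W x * I x)"
    using W_bd K by (auto intro!: integrable_const_bound[where B = K] simp: I_def indicator_def)
  note ce = real_cond_exp_intg[OF int(2) W \<open>I \<in> borel_measurable M\<close>]
  have "expectation (\<lambda>x. W x * I x) = expectation (\<lambda>x. W x * real_cond_exp M F I x)"
    using ce(2) by simp
  also have "\<dots> \<le> expectation (\<lambda>x. q * W x)"
    using tail W_bd(1) ce(1) int(1)
    by (intro integral_mono_AE) (auto simp: I_def mult.commute[of q] intro!: mult_left_mono)
  finally show ?thesis by (simp add: I_def)
qed

text \<open>The weighted tail bounds hold for all levels \<open>t\<close>, so they say that under the measure with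
  density \<open>W\<close> the tails of \<open>X\<close> are at most \<open>E W\<close> times those of \<open>\<phi>\<close>; integrating over \<open>t\<close> transfers
  the comparison to moments.\<close>

lemma weighted_moment_le:
  fixes X W \<phi> :: "'a \<Rightarrow> real"
  assumes sub: "subalgebra M F" and X [measurable]: "X \<in> borel_measurable M"
    and tails: "\<And>t. 0 < t \<Longrightarrow> AE x in M.
      real_cond_exp M F (indicator {y \<in> space M. \<bar>X y\<bar> > t}) x \<le> prob {y \<in> space M. \<phi> y > t}"
    and W: "W \<in> borel_measurable F" and W_bd: "\<And>x. 0 \<le> W x" "\<And>x. W x \<le> K"
    and [measurable]: "\<phi> \<in> borel_measurable M" and \<phi>: "integrable M (\<lambda>x. \<bar>\<phi> x\<bar> powr r)" and "0 < r"
  shows "integrable M (\<lambda>x. W x * \<bar>X x\<bar> powr r)"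
    and "expectation (\<lambda>x. W x * \<bar>X x\<bar> powr r) \<le> expectation W * expectation (\<lambda>x. \<bar>\<phi> x\<bar> powr r)"
proof -
  have [measurable]: "W \<in> borel_measurable M" by (rule measurable_from_subalg[OF sub W])
  have K: "0 \<le> K" using W_bd order_trans by blast
  have intW: "integrable M W"
    using W_bd K by (auto intro!: integrable_const_bound[where B = K])
  define N where "N = density M (\<lambda>x. ennreal (W x))"
  have "emeasure N (space N) = ennreal (expectation W)"
    using intW W_bd(1) by (simp add: N_def emeasure_density nn_integral_eq_integral cong: nn_integral_cong_simp)
  then have "finite_measure N" by (intro finite_measureI) simp
  then have N: "sigma_finite_measure N" by (rule finite_measure.axioms)
  have "(\<integral>\<^sup>+x. ennreal (W x * \<bar>X x\<bar> powr r) \<partial>M) = (\<integral>\<^sup>+x. ennreal (\<bar>X x\<bar> powr r) \<partial>N)"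
    using W_bd(1) by (simp add: N_def nn_integral_density ennreal_mult)
  also have "\<dots> \<le> ennreal (expectation W) * (\<integral>\<^sup>+x. ennreal (\<bar>\<phi> x\<bar> powr r) \<partial>M)"
  proof (rule nn_integral_powr_mono_tails[OF N _ sigma_finite_measure_axioms _ \<open>0 < r\<close>])
    fix t :: real assume t: "0 < t"
    let ?A = "{y \<in> space M. \<bar>X y\<bar> > t}"
    have int: "integrable M (\<lambda>x. W x * indicator ?A x)"
      using W_bd K by (auto intro!: integrable_const_bound[where B = K] simp: indicator_def)
    have "emeasure N ?A = (\<integral>\<^sup>+x. ennreal (W x * indicator ?A x) \<partial>M)"
      unfolding N_def by (subst emeasure_density)
        (auto intro!: nn_integral_cong simp: indicator_def)
    also have "\<dots> = ennreal (expectation (\<lambda>x. W x * indicator ?A x))"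
      using W_bd(1) int by (intro nn_integral_eq_integral) auto
    also have "\<dots> \<le> ennreal (prob {y \<in> space M. \<phi> y > t} * expectation W)"
      by (intro ennreal_leI weighted_tail_le[OF sub X tails[OF t] W W_bd])
    also have "\<dots> \<le> ennreal (expectation W * prob {y \<in> space M. t < \<bar>\<phi> y\<bar>})"
      using W_bd(1) by (subst mult.commute)
        (auto intro!: ennreal_leI mult_left_mono finite_measure_mono)
    also have "\<dots> = ennreal (expectation W) * emeasure M {y \<in> space M. t < \<bar>\<phi> y\<bar>}"
      using W_bd(1) by (simp add: ennreal_mult emeasure_eq_measure)
    finally show "emeasure N {x \<in> space N. t < \<bar>X x\<bar>} \<le> \<dots>"
      by (simp add: N_def)
  qed (auto simp: N_def)
  also have "(\<integral>\<^sup>+x. ennreal (\<bar>\<phi> x\<bar> powr r) \<partial>M) = ennreal (expectation (\<lambda>x. \<bar>\<phi> x\<bar> powr r))"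
    using \<phi> by (intro nn_integral_eq_integral) auto
  finally have le: "(\<integral>\<^sup>+x. ennreal (W x * \<bar>X x\<bar> powr r) \<partial>M)
    \<le> ennreal (expectation W * expectation (\<lambda>x. \<bar>\<phi> x\<bar> powr r))"
    using W_bd(1) by (simp add: ennreal_mult)
  show int: "integrable M (\<lambda>x. W x * \<bar>X x\<bar> powr r)"
    using le W_bd(1) by (intro integrableI_nonneg) (auto simp: le_less_trans)
  show "expectation (\<lambda>x. W x * \<bar>X x\<bar> powr r) \<le> expectation W * expectation (\<lambda>x. \<bar>\<phi> x\<bar> powr r)"
    using le W_bd(1) by (subst (asm) nn_integral_eq_integral[OF int]) (auto simp: ennreal_le_iff)
qed

text \<open>Integrating the pointwise bound against \<open>W\<close>: the linear term disappears by the martingale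
  property and the power term is a weighted moment.\<close>

lemma weighted_exp_truncation_le:
  fixes X W \<phi> :: "'a \<Rightarrow> real"
  assumes sub: "subalgebra M F" and intX: "integrable M X"
    and mart: "AE x in M. real_cond_exp M F X x = 0"
    and tails: "\<And>t. 0 < t \<Longrightarrow> AE x in M.
      real_cond_exp M F (indicator {y \<in> space M. \<bar>X y\<bar> > t}) x \<le> prob {y \<in> space M. \<phi> y > t}"
    and W: "W \<in> borel_measurable F" and W_bd: "\<And>x. 0 \<le> W x" "\<And>x. W x \<le> K"
    and \<phi>: "\<phi> \<in> borel_measurable M" "integrable M (\<lambda>x. \<bar>\<phi> x\<bar> powr r)"
    and par: "1 < r" "r \<le> 2" "0 < c" "0 \<le> l"
  shows "expectation (\<lambda>x. W x * exp (l * truncation c (X x)))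
    \<le> expectation W * (1 + exp_excess r c l * expectation (\<lambda>x. \<bar>\<phi> x\<bar> powr r))"
proof -
  interpret sigma_finite_subalgebra M F by (rule sigma_finite_subalgebraI[OF sub])
  have [measurable]: "W \<in> borel_measurable M" by (rule measurable_from_subalg[OF sub W])
  have [measurable]: "X \<in> borel_measurable M" using intX by simp
  have K: "0 \<le> K" using W_bd order_trans by blast
  have intW: "integrable M W"
    using W_bd K by (auto intro!: integrable_const_bound[where B = K])
  have intWX: "integrable M (\<lambda>x. W x * X x)"
  proof (rule Bochner_Integration.integrable_bound)
    show "integrable M (\<lambda>x. K * X x)" using intX by simp
    have "norm (W x * X x) \<le> norm (K * X x)" for x
      unfolding norm_mult using W_bd[of x] K by (intro mult_right_mono) simp_all
    then show "AE x in M. norm (W x * X x) \<le> norm (K * X x)" by simp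
  qed measurable
  have "expectation (\<lambda>x. W x * X x) = expectation (\<lambda>x. W x * real_cond_exp M F X x)"
    by (rule real_cond_exp_intg(2)[OF intWX W, symmetric]) simp
  also have "\<dots> = expectation (\<lambda>x. 0)"
    using mart by (intro integral_cong_AE) auto
  finally have EWX: "expectation (\<lambda>x. W x * X x) = 0" by simp
  have ex: "0 \<le> exp_excess r c l" using par by (simp add: exp_excess_def)
  have "0 < r" using par by simp
  note moment = weighted_moment_le[OF sub \<open>X \<in> borel_measurable M\<close> tails W W_bd \<phi> this]
  have "integrable M (\<lambda>x. W x * exp (l * truncation c (X x)))"
  proof (rule integrable_const_bound)
    have "norm (W x * exp (l * truncation c (X x))) \<le> K * exp (l * c)" for x
    proof -
      have "l * truncation c (X x) \<le> l * c"
        using abs_truncation_le[of c "X x"] par by (intro mult_left_mono) auto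
      then show ?thesis
        unfolding norm_mult using W_bd[of x] K by (intro mult_mono) simp_all
    qed
    then show "AE x in M. norm (W x * exp (l * truncation c (X x))) \<le> K * exp (l * c)" by simp
  qed measurable
  then have "expectation (\<lambda>x. W x * exp (l * truncation c (X x)))
    \<le> expectation (\<lambda>x. W x + l * (W x * X x) + exp_excess r c l * (W x * \<bar>X x\<bar> powr r))"
  proof (rule integral_mono)
    fix x
    show "W x * exp (l * truncation c (X x))
      \<le> W x + l * (W x * X x) + exp_excess r c l * (W x * \<bar>X x\<bar> powr r)"
      using mult_left_mono[OF exp_truncation_le[OF par, of "X x"] W_bd(1)[of x]]
      by (simp add: algebra_simps)
  qed (use intW intWX moment(1) in auto)
  also have "\<dots> = expectation W + exp_excess r c l * expectation (\<lambda>x. W x * \<bar>X x\<bar> powr r)"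
    using intW intWX moment(1) EWX by simp
  also have "\<dots> \<le> expectation W + exp_excess r c l * (expectation W * expectation (\<lambda>x. \<bar>\<phi> x\<bar> powr r))"
    using ex moment(2) by (intro add_left_mono mult_left_mono)
  finally show ?thesis by (simp add: algebra_simps)
qed

end

section \<open>Exponential bound for martingales with dominated increments\<close>

definition dominated_increments ::
    "'a measure \<Rightarrow> (nat \<Rightarrow> 'a measure) \<Rightarrow> (nat \<Rightarrow> 'a \<Rightarrow> real) \<Rightarrow> ('a \<Rightarrow> real) \<Rightarrow> bool" where
  "dominated_increments M B X \<phi> \<longleftrightarrow> (\<forall>n\<ge>1. \<forall>t>0. AE x in M.
     real_cond_exp M (B (n - 1)) (indicator {y \<in> space M. \<bar>X n y\<bar> > t}) x
       \<le> measure M {y \<in> space M. \<phi> y > t})"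

lemma martingale_difference_uminus:
  assumes "prob_space M" "sub_sigma_filtration M B" "martingale_difference M B X"
  shows "martingale_difference M B (\<lambda>k x. - X k x)"
  unfolding martingale_difference_def
proof (intro allI impI conjI)
  interpret prob_space M by fact
  fix n :: nat assume n: "1 \<le> n"
  then have X: "integrable M (X n)" "X n \<in> borel_measurable (B n)"
    "AE x in M. real_cond_exp M (B (n - 1)) (X n) x = 0"
    using assms(3) by (auto simp: martingale_difference_def)
  show "integrable M (\<lambda>x. - X n x)" "(\<lambda>x. - X n x) \<in> borel_measurable (B n)"
    using X(1,2) by auto
  interpret sigma_finite_subalgebra M "B (n - 1)"
    using assms(2) by (intro sigma_finite_subalgebraI) (simp add: sub_sigma_filtration_def)
  have "AE x in M. real_cond_exp M (B (n - 1)) (\<lambda>x. (- 1) * X n x) x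
    = (- 1) * real_cond_exp M (B (n - 1)) (X n) x"
    by (rule real_cond_exp_cmult) (rule X(1))
  with X(3) show "AE x in M. real_cond_exp M (B (n - 1)) (\<lambda>x. - X n x) x = 0" by auto
qed

lemma increment_measurable_later:
  assumes filt: "sub_sigma_filtration M B" and "martingale_difference M B X" "1 \<le> k" "k \<le> n"
  shows "X k \<in> borel_measurable (B n)"
proof -
  interpret filtration "space M" B using filt by (simp add: sub_sigma_filtration_def)
  have "subalgebra (B n) (B k)"
    using sets_F_mono[OF \<open>k \<le> n\<close>] by (simp add: subalgebra_def space_F)
  then show ?thesis
    by (rule measurable_from_subalg) (use assms in \<open>simp add: martingale_difference_def\<close>)
qed

context prob_space
begin

lemma increment_tail_le:
  assumes filt: "sub_sigma_filtration M B" and mart: "martingale_difference M B X"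
    and dom: "dominated_increments M B X \<phi>" and "0 < c" "1 \<le> k"
  shows "prob {x \<in> space M. \<bar>X k x\<bar> > c} \<le> prob {x \<in> space M. \<phi> x > c}"
proof -
  have sub: "subalgebra M (B (k - 1))" using filt by (simp add: sub_sigma_filtration_def)
  have [measurable]: "X k \<in> borel_measurable M"
    using mart \<open>1 \<le> k\<close> by (auto simp: martingale_difference_def)
  have tail: "AE x in M. real_cond_exp M (B (k - 1)) (indicator {y \<in> space M. \<bar>X k y\<bar> > c}) x
      \<le> prob {y \<in> space M. \<phi> y > c}"
    using dom \<open>0 < c\<close> \<open>1 \<le> k\<close> by (auto simp: dominated_increments_def)
  show ?thesis
    using weighted_tail_le[OF sub _ tail, of "\<lambda>_. 1" 1] by (simp add: prob_space)
qed

context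
  fixes B :: "nat \<Rightarrow> 'a measure" and X :: "nat \<Rightarrow> 'a \<Rightarrow> real" and \<phi> :: "'a \<Rightarrow> real" and r c l :: real
  assumes filt: "sub_sigma_filtration M B"
    and mart: "martingale_difference M B X"
    and dom: "dominated_increments M B X \<phi>"
    and \<phi>_meas [measurable]: "\<phi> \<in> borel_measurable M"
    and \<phi>_int: "integrable M (\<lambda>x. \<bar>\<phi> x\<bar> powr r)"
    and r: "1 < r" "r \<le> 2" and c: "0 < c" and l: "0 < l"
begin

text \<open>The exponential of the first \<open>n\<close> truncated increments is a bounded weight that is measurable
  with respect to the past of the next increment, so the one-increment bound can be iterated.\<close>

lemma exp_truncated_sum_le:
  shows "expectation (\<lambda>x. exp (l * (\<Sum>k=1..n. truncation c (X k x))))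
    \<le> (1 + exp_excess r c l * expectation (\<lambda>x. \<bar>\<phi> x\<bar> powr r)) ^ n" (is "_ \<le> ?q ^ n")
proof (induction n)
  case 0
  show ?case by (simp add: prob_space)
next
  case (Suc n)
  define W where "W x = exp (l * (\<Sum>k=1..n. truncation c (X k x)))" for x
  have "0 \<le> ?q" using c l by (auto simp: exp_excess_def intro!: add_nonneg_nonneg mult_nonneg_nonneg)
  have *: "integrable M (X (Suc n))" "AE x in M. real_cond_exp M (B n) (X (Suc n)) x = 0"
    using mart by (auto simp: martingale_difference_def dest: spec[of _ "Suc n"])
  have tails: "AE x in M. real_cond_exp M (B n) (indicator {y \<in> space M. \<bar>X (Suc n) y\<bar> > t}) x
      \<le> prob {y \<in> space M. \<phi> y > t}" if "0 < t" for t
    using dom that by (auto simp: dominated_increments_def dest: spec[of _ "Suc n"])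
  have meas: "X k \<in> borel_measurable (B n)" if "k \<in> {1..n}" for k
    using increment_measurable_later[OF filt mart] that by simp
  have [measurable]: "(\<lambda>x. \<Sum>k=1..n. truncation c (X k x)) \<in> borel_measurable (B n)"
    by (intro borel_measurable_sum measurable_compose[OF meas measurable_truncation])
  have W: "W \<in> borel_measurable (B n)"
    unfolding W_def by measurable
  have W_bd: "W x \<le> exp (l * (\<Sum>k=1..n. c))" for x
    unfolding W_def exp_le_cancel_iff using l c abs_truncation_le[of c "X _ x"]
    by (intro mult_left_mono sum_mono) (auto intro: order_trans[OF abs_ge_self])
  have "expectation (\<lambda>x. exp (l * (\<Sum>k=1..Suc n. truncation c (X k x))))
    = expectation (\<lambda>x. W x * exp (l * truncation c (X (Suc n) x)))"
    by (simp add: W_def distrib_left exp_add)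
  also have "\<dots> \<le> expectation W * ?q"
    using filt
    by (intro weighted_exp_truncation_le[OF _ * tails W _ W_bd \<phi>_meas \<phi>_int r c less_imp_le[OF l]])
      (auto simp: sub_sigma_filtration_def W_def)
  also have "\<dots> \<le> ?q ^ n * ?q"
    using Suc.IH \<open>0 \<le> ?q\<close> unfolding W_def by (rule mult_right_mono)
  finally show ?case by (simp add: mult.commute)
qed

text \<open>Markov's inequality puts \<open>- l * \<epsilon>\<close> per increment into the exponent, and by the smallness
  assumption the growth of the exponential moment gives back at most half of it.\<close>

lemma truncated_sum_tail_le:
  assumes small: "exp_excess r c l * expectation (\<lambda>x. \<bar>\<phi> x\<bar> powr r) \<le> l * \<epsilon> / 2"
  shows "prob {x \<in> space M. (\<Sum>k=1..n. truncation c (X k x)) > real n * \<epsilon>} \<le> exp (- (real n * l * \<epsilon> / 2))"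
proof -
  let ?S = "\<lambda>x. \<Sum>k=1..n. truncation c (X k x)"
  let ?q = "exp_excess r c l * expectation (\<lambda>x. \<bar>\<phi> x\<bar> powr r)"
  have [measurable]: "X k \<in> borel_measurable M" if "k \<in> {1..n}" for k
    using mart that by (auto simp: martingale_difference_def)
  have S [measurable]: "?S \<in> borel_measurable M"
    by (intro borel_measurable_sum measurable_compose[OF _ measurable_truncation]) auto
  have bd: "norm (exp (l * ?S x)) \<le> exp (l * (\<Sum>k=1..n. c))" for x
  proof -
    have "?S x \<le> (\<Sum>k=1..n. c)"
      using c by (intro sum_mono order_trans[OF abs_ge_self abs_truncation_le]) simp
    then have "l * ?S x \<le> l * (\<Sum>k=1..n. c)" using l by (intro mult_left_mono) auto
    then show "norm (exp (l * ?S x)) \<le> exp (l * (\<Sum>k=1..n. c))" by simp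
  qed
  have int: "integrable M (\<lambda>x. exp (l * ?S x))"
    by (rule integrable_const_bound[OF AE_I2[OF bd]]) measurable
  have q: "0 \<le> ?q"
    using c l by (auto simp: exp_excess_def intro!: mult_nonneg_nonneg)
  have "prob {x \<in> space M. ?S x > real n * \<epsilon>}
    \<le> prob {x \<in> space M. exp (l * ?S x) \<ge> exp (l * (real n * \<epsilon>))}"
    using l by (intro finite_measure_mono) auto
  also have "\<dots> \<le> expectation (\<lambda>x. exp (l * ?S x)) / exp (l * (real n * \<epsilon>))"
    by (rule integral_Markov_inequality_measure[OF int]) auto
  also have "\<dots> \<le> (1 + ?q) ^ n / exp (l * (real n * \<epsilon>))"
    using exp_truncated_sum_le[of n] by (intro divide_right_mono) auto
  also have "(1 + ?q) ^ n \<le> exp ?q ^ n"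
    using exp_ge_add_one_self[of ?q] q by (intro power_mono) auto
  also have "\<dots> \<le> exp (l * \<epsilon> / 2) ^ n"
    using small by (intro power_mono) auto
  also have "exp (l * \<epsilon> / 2) ^ n / exp (l * (real n * \<epsilon>)) = exp (- (real n * l * \<epsilon> / 2))"
    by (simp add: exp_of_nat_mult[symmetric] exp_diff[symmetric])
  finally show ?thesis by (simp add: divide_right_mono)
qed

end

text \<open>Unless one of the increments exceeds \<open>c\<close>, the martingale coincides with its truncated sum. Applying
  the one-sided bound to \<open>X\<close> and to \<open>-X\<close> covers both signs.\<close>

lemma martingale_tail_le:
  assumes filt: "sub_sigma_filtration M B" and mart: "martingale_difference M B X"
    and dom: "dominated_increments M B X \<phi>"
    and \<phi>: "\<phi> \<in> borel_measurable M" "integrable M (\<lambda>x. \<bar>\<phi> x\<bar> powr r)" and r: "1 < r" "r \<le> 2"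
    and par: "0 < c" "0 < l"
    and small: "exp_excess r c l * expectation (\<lambda>x. \<bar>\<phi> x\<bar> powr r) \<le> l * \<epsilon> / 2"
  shows "prob {x \<in> space M. \<bar>\<Sum>k=1..n. X k x\<bar> > real n * \<epsilon>}
    \<le> real n * prob {x \<in> space M. \<phi> x > c} + 2 * exp (- (real n * l * \<epsilon> / 2))"
proof -
  let ?Y = "\<lambda>k x. truncation c (X k x)" and ?Z = "\<lambda>k x. truncation c (- X k x)"
  let ?J = "\<Union>k\<in>{1..n}. {x \<in> space M. \<bar>X k x\<bar> > c}"
  let ?P = "{x \<in> space M. (\<Sum>k=1..n. ?Y k x) > real n * \<epsilon>}"
  let ?N = "{x \<in> space M. (\<Sum>k=1..n. ?Z k x) > real n * \<epsilon>}"
  have X [measurable]: "X k \<in> borel_measurable M" if "k \<in> {1..n}" for k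
    using mart that by (auto simp: martingale_difference_def)
  have [measurable]: "(\<lambda>x. \<Sum>k=1..n. ?Y k x) \<in> borel_measurable M"
    "(\<lambda>x. \<Sum>k=1..n. ?Z k x) \<in> borel_measurable M"
    by (auto intro!: borel_measurable_sum measurable_compose[OF _ measurable_truncation]
        borel_measurable_uminus X)
  have sets: "?J \<in> events" "?P \<in> events" "?N \<in> events"
    by measurable
  have "{x \<in> space M. \<bar>\<Sum>k=1..n. X k x\<bar> > real n * \<epsilon>} \<subseteq> ?J \<union> (?P \<union> ?N)"
  proof (rule subsetI, rule ccontr)
    fix x assume x: "x \<in> {x \<in> space M. \<bar>\<Sum>k=1..n. X k x\<bar> > real n * \<epsilon>}" "x \<notin> ?J \<union> (?P \<union> ?N)"
    then have "\<And>k. k \<in> {1..n} \<Longrightarrow> ?Y k x = X k x" by (auto simp: truncation_def not_less)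
    then have "(\<Sum>k=1..n. ?Y k x) = (\<Sum>k=1..n. X k x)" by (intro sum.cong) auto
    moreover have "(\<Sum>k=1..n. ?Z k x) = - (\<Sum>k=1..n. ?Y k x)"
      by (simp add: truncation_minus sum_negf)
    ultimately show False using x by (auto simp: abs_if split: if_splits)
  qed
  then have "prob {x \<in> space M. \<bar>\<Sum>k=1..n. X k x\<bar> > real n * \<epsilon>} \<le> prob (?J \<union> (?P \<union> ?N))"
    using sets by (intro finite_measure_mono) auto
  also have "\<dots> \<le> prob ?J + prob (?P \<union> ?N)" using sets by (intro measure_Un_le) auto
  also have "prob (?P \<union> ?N) \<le> prob ?P + prob ?N" using sets by (intro measure_Un_le) auto
  also have "prob ?J \<le> (\<Sum>k\<in>{1..n}. prob {x \<in> space M. \<bar>X k x\<bar> > c})"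
    by (intro finite_measure_subadditive_finite) auto
  also have "\<dots> \<le> (\<Sum>k\<in>{1..n}. prob {x \<in> space M. \<phi> x > c})"
    by (intro sum_mono increment_tail_le[OF filt mart dom par(1)]) auto
  also have "prob ?P \<le> exp (- (real n * l * \<epsilon> / 2))"
    by (rule truncated_sum_tail_le[OF filt mart dom \<phi> r par small])
  also have "prob ?N \<le> exp (- (real n * l * \<epsilon> / 2))"
  proof (rule truncated_sum_tail_le[OF filt _ _ \<phi> r par small])
    show "dominated_increments M B (\<lambda>k x. - X k x) \<phi>"
      using dom by (simp add: dominated_increments_def)
    show "martingale_difference M B (\<lambda>k x. - X k x)"
      by (rule martingale_difference_uminus[OF prob_space_axioms filt mart])
  qed
  finally show ?thesis by simp
qed

end

section \<open>Summability and choice of parameters\<close>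

context prob_space
begin

text \<open>Exchanging sum and expectation, the series becomes the expectation of the sum of
  \<open>n powr (p - 1)\<close> over the integers \<open>1 \<le> n < \<phi> / d\<close>. With \<open>y = \<bar>\<phi>\<bar> / d\<close> there are at most \<open>y\<close> terms, each
  at most \<open>y powr (p - 1)\<close>, so the expectation is at most that of \<open>y powr p\<close>.\<close>

lemma summable_powr_tail:
  fixes \<phi> :: "'a \<Rightarrow> real"
  assumes p: "1 < p" and [measurable]: "\<phi> \<in> borel_measurable M"
    and \<phi>: "integrable M (\<lambda>x. \<bar>\<phi> x\<bar> powr p)" and d: "0 < d"
  shows "summable (\<lambda>n. real n powr (p - 1) * prob {x \<in> space M. \<phi> x > d * real n})"
proof (rule summableI_nonneg_bounded)
  let ?A = "\<lambda>n. {x \<in> space M. \<phi> x > d * real n}"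
  fix N :: nat
  have int: "integrable M (\<lambda>x. real n powr (p - 1) * indicator (?A n) x)" for n
    by (intro integrable_mult_right integrable_real_indicator) (auto simp: emeasure_eq_measure)
  have pointwise: "(\<Sum>n<N. real n powr (p - 1) * indicator (?A n) x) \<le> \<bar>\<phi> x\<bar> powr p / d powr p" for x
  proof -
    define y where "y = \<bar>\<phi> x\<bar> / d"
    have y: "0 \<le> y" using d by (simp add: y_def)
    have A: "real n < y" if "x \<in> ?A n" for n
      using that d by (auto simp: y_def field_simps)
    have "(\<Sum>n<N. real n powr (p - 1) * indicator (?A n) x)
      = (\<Sum>n\<in>{n\<in>{1..<N}. x \<in> ?A n}. real n powr (p - 1))"
      by (rule sum.mono_neutral_cong_right) (auto simp: indicator_def not_less_eq_eq)
    also have "\<dots> \<le> (\<Sum>n\<in>{n\<in>{1..<N}. x \<in> ?A n}. y powr (p - 1))"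
      using A p by (intro sum_mono powr_mono2) (auto intro: less_imp_le)
    also have "\<dots> = real (card {n\<in>{1..<N}. x \<in> ?A n}) * y powr (p - 1)" by simp
    also have "\<dots> \<le> y * y powr (p - 1)"
    proof (rule mult_right_mono)
      have "card {n\<in>{1..<N}. x \<in> ?A n} \<le> card {1..nat \<lfloor>y\<rfloor>}"
        using A by (intro card_mono) (auto simp: le_nat_floor less_imp_le)
      then show "real (card {n\<in>{1..<N}. x \<in> ?A n}) \<le> y" using y by simp linarith
    qed simp
    also have "\<dots> = y powr p" using y by (cases "y = 0") (auto simp: powr_mult_base)
    also have "\<dots> = \<bar>\<phi> x\<bar> powr p / d powr p" using d by (simp add: y_def powr_divide)
    finally show ?thesis .
  qed
  have "(\<Sum>n<N. real n powr (p - 1) * prob (?A n))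
    = expectation (\<lambda>x. \<Sum>n<N. real n powr (p - 1) * indicator (?A n) x)"
    using int by (subst Bochner_Integration.integral_sum) auto
  also have "\<dots> \<le> expectation (\<lambda>x. \<bar>\<phi> x\<bar> powr p / d powr p)"
  proof (rule integral_mono)
    show "integrable M (\<lambda>x. \<Sum>n<N. real n powr (p - 1) * indicator (?A n) x)"
      by (rule Bochner_Integration.integrable_sum) (rule int)
    show "integrable M (\<lambda>x. \<bar>\<phi> x\<bar> powr p / d powr p)"
      using \<phi> by simp
  qed (rule pointwise)
  finally show "(\<Sum>n<N. real n powr (p - 1) * prob (?A n)) \<le> expectation (\<lambda>x. \<bar>\<phi> x\<bar> powr p / d powr p)" .
qed simp

lemma integrable_powr_smaller_exponent:
  fixes \<phi> :: "'a \<Rightarrow> real"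
  assumes [measurable]: "\<phi> \<in> borel_measurable M" and "integrable M (\<lambda>x. \<bar>\<phi> x\<bar> powr p)"
    and "0 < r" "r \<le> p"
  shows "integrable M (\<lambda>x. \<bar>\<phi> x\<bar> powr r)"
proof (rule Bochner_Integration.integrable_bound)
  show "integrable M (\<lambda>x. 1 + \<bar>\<phi> x\<bar> powr p)" using assms by simp
  have "\<bar>\<phi> x\<bar> powr r \<le> 1 + \<bar>\<phi> x\<bar> powr p" for x
  proof (cases "\<bar>\<phi> x\<bar> \<le> 1")
    case True
    then have "\<bar>\<phi> x\<bar> powr r \<le> 1" using \<open>0 < r\<close> by (intro powr_le1) auto
    then show ?thesis by (simp add: add_increasing2)
  next
    case False
    then have "\<bar>\<phi> x\<bar> powr r \<le> \<bar>\<phi> x\<bar> powr p" using \<open>r \<le> p\<close> by (intro powr_mono) auto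
    then show ?thesis by simp
  qed
  then show "AE x in M. norm (\<bar>\<phi> x\<bar> powr r) \<le> norm (1 + \<bar>\<phi> x\<bar> powr p)" by auto
qed measurable

end

text \<open>After division by \<open>l = a * ln n / n\<close>, the first summand of \<open>exp_excess\<close> is of order
  \<open>n powr (- (r - 1))\<close> and, up to powers of \<open>ln n\<close>, the second one of order
  \<open>n powr (- (r - 1)) * n powr (a * \<delta>) = n powr (- (r - 1) / 2)\<close>.\<close>

lemma eventually_exp_excess_le:
  fixes r \<delta> a m e :: real
  assumes r: "1 < r" and "0 < \<delta>" "0 < a" "a * \<delta> = (r - 1) / 2" "0 < e"
  shows "eventually (\<lambda>n. exp_excess r (\<delta> * real n) (a * ln (real n) / real n) * m
    \<le> a * ln (real n) / real n * e) sequentially"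
proof -
  define s where "s = r - 1"
  have s: "0 < s" using r by (simp add: s_def)
  have "(\<lambda>n::nat. ((\<delta> * real n) powr (- s) +
      (a * ln (real n) / real n) powr s * real n powr (s / 2)) * m) \<longlonglongrightarrow> 0"
    using s \<open>0 < \<delta>\<close> \<open>0 < a\<close> by real_asymp
  then have "eventually (\<lambda>n::nat. ((\<delta> * real n) powr (- s) +
      (a * ln (real n) / real n) powr s * real n powr (s / 2)) * m < e) sequentially"
    using \<open>0 < e\<close> by (rule order_tendstoD)
  then show ?thesis
    using eventually_ge_at_top[of 2]
  proof eventually_elim
    case (elim n)
    define l where "l = a * ln (real n) / real n"
    have l: "0 < l" using elim(2) \<open>0 < a\<close> by (simp add: l_def)
    have "l * (\<delta> * real n) = (a * \<delta>) * ln (real n)" using elim(2) by (simp add: l_def)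
    then have "exp (l * (\<delta> * real n)) = real n powr (s / 2)"
      using elim(2) assms by (simp add: powr_def s_def)
    moreover have "l powr r = l * l powr s"
      using l by (simp add: s_def powr_mult_base)
    ultimately have "exp_excess r (\<delta> * real n) l * m =
      l * (((\<delta> * real n) powr (- s) + l powr s * real n powr (s / 2)) * m)"
      by (simp add: exp_excess_def s_def algebra_simps)
    also have "\<dots> \<le> l * e" using l elim(1) by (intro mult_left_mono) (auto simp: l_def)
    finally show ?case by (simp add: l_def)
  qed
qed

theorem theorem2p2:
  fixes M :: "'a measure" and p \<epsilon> :: real and \<phi> :: "'a \<Rightarrow> real"
  assumes "prob_space M"
    and "p > 1"
    and "in_Lp M p \<phi>"
    and "AE x in M. \<phi> x \<ge> 0"
    and "\<epsilon> > 0"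
  shows "\<exists>C :: nat \<Rightarrow> real.
    (\<lambda>n. real n powr (p - 2) * C n) summable_on {1..} \<and>
    (\<forall>(B :: nat \<Rightarrow> 'a measure) (X :: nat \<Rightarrow> 'a \<Rightarrow> real).
      sub_sigma_filtration M B \<longrightarrow>
      martingale_difference M B X \<longrightarrow>
      (\<forall>n\<ge>1. \<forall>t>0. AE x in M.
         real_cond_exp M (B (n - 1)) (indicator {y \<in> space M. \<bar>X n y\<bar> > t}) x
           \<le> measure M {y \<in> space M. \<phi> y > t}) \<longrightarrow>
      (\<forall>n\<ge>1. measure M {x \<in> space M. \<bar>\<Sum>k=1..n. X k x\<bar> > real n * \<epsilon>} \<le> C n))"
proof -
  interpret prob_space M by fact
  have \<phi> [measurable]: "\<phi> \<in> borel_measurable M" and int_p: "integrable M (\<lambda>x. \<bar>\<phi> x\<bar> powr p)"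
    using \<open>in_Lp M p \<phi>\<close> by (auto simp: in_Lp_def)
  define r where "r = min p 2"
  have r: "1 < r" "r \<le> 2" "r \<le> p" using \<open>p > 1\<close> by (auto simp: r_def)
  have int_r: "integrable M (\<lambda>x. \<bar>\<phi> x\<bar> powr r)"
    by (rule integrable_powr_smaller_exponent[OF \<phi> int_p]) (use r in auto)
  define a where "a = 2 * p / \<epsilon>"
  define \<delta> where "\<delta> = (r - 1) / (2 * a)"
  have a: "0 < a" using \<open>p > 1\<close> \<open>\<epsilon> > 0\<close> by (simp add: a_def)
  have \<delta>: "0 < \<delta>" "a * \<delta> = (r - 1) / 2" using a r by (auto simp: \<delta>_def)
  define l where "l n = a * ln (real n) / real n" for n :: nat
  have "eventually (\<lambda>n. exp_excess r (\<delta> * real n) (l n) * expectation (\<lambda>x. \<bar>\<phi> x\<bar> powr r)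
    \<le> l n * (\<epsilon> / 2)) sequentially"
    unfolding l_def by (rule eventually_exp_excess_le) (use r a \<delta> \<open>\<epsilon> > 0\<close> in auto)
  then obtain n\<^sub>0 where n\<^sub>0: "\<And>n. n \<ge> n\<^sub>0 \<Longrightarrow>
    exp_excess r (\<delta> * real n) (l n) * expectation (\<lambda>x. \<bar>\<phi> x\<bar> powr r) \<le> l n * \<epsilon> / 2"
    by (auto simp: eventually_at_top_linorder)
  \<comment> \<open>The finitely many small indices get the trivial bound \<open>1\<close>; the index \<open>1\<close> is among them
      because \<open>l 1 = 0\<close>.\<close>
  define C where "C n = (if n < max 2 n\<^sub>0 then 1 else
    real n * prob {x \<in> space M. \<phi> x > \<delta> * real n} + 2 * real n powr (- p))" for n
  show ?thesis
  proof (intro exI[of _ C] conjI allI impI)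
    let ?f = "\<lambda>n. real n powr (p - 1) * prob {x \<in> space M. \<phi> x > \<delta> * real n} + 2 * real n powr (- 2)"
    have "summable ?f"
      by (intro summable_add summable_mult summable_powr_tail)
        (use \<open>p > 1\<close> \<phi> int_p \<delta> in \<open>auto simp: summable_real_powr_iff\<close>)
    moreover have "eventually (\<lambda>n. real n powr (p - 2) * C n = ?f n) sequentially"
      using eventually_ge_at_top[of "max 2 n\<^sub>0"]
    proof eventually_elim
      case (elim n)
      then have n: "0 < real n" by auto
      have "real n powr (p - 2) * real n = real n powr (p - 1)"
        using powr_add[of "real n" "p - 2" 1] n by simp
      moreover have "real n powr (p - 2) * real n powr (- p) = real n powr (- 2)"
        using powr_add[of "real n" "p - 2" "- p"] by simp
      moreover have "\<not> n < max 2 n\<^sub>0" using elim by linarith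
      ultimately show ?case by (simp add: C_def algebra_simps mult.assoc[symmetric])
    qed
    ultimately have "summable (\<lambda>n. real n powr (p - 2) * C n)"
      by (simp add: summable_cong)
    then have "(\<lambda>n. real n powr (p - 2) * C n) summable_on UNIV"
      by (rule summable_nonneg_imp_summable_on) (auto simp: C_def)
    then show "(\<lambda>n. real n powr (p - 2) * C n) summable_on {1..}"
      by (rule summable_on_subset_banach) auto
  next
    fix B :: "nat \<Rightarrow> 'a measure" and X :: "nat \<Rightarrow> 'a \<Rightarrow> real" and n :: nat
    assume filt: "sub_sigma_filtration M B" and mart: "martingale_difference M B X"
      and "\<forall>n\<ge>1. \<forall>t>0. AE x in M.
         real_cond_exp M (B (n - 1)) (indicator {y \<in> space M. \<bar>X n y\<bar> > t}) x
           \<le> measure M {y \<in> space M. \<phi> y > t}"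
      and "1 \<le> n"
    then have dom: "dominated_increments M B X \<phi>" by (simp add: dominated_increments_def)
    show "prob {x \<in> space M. \<bar>\<Sum>k=1..n. X k x\<bar> > real n * \<epsilon>} \<le> C n"
    proof (cases "n < max 2 n\<^sub>0")
      case True
      then show ?thesis by (simp add: C_def)
    next
      case False
      then have n: "2 \<le> n" "n\<^sub>0 \<le> n" by auto
      have l: "0 < l n" using a n by (simp add: l_def)
      have "real n * l n * \<epsilon> / 2 = p * ln (real n)"
        using n \<open>\<epsilon> > 0\<close> by (simp add: l_def a_def)
      then have "exp (- (real n * l n * \<epsilon> / 2)) = real n powr (- p)"
        using n by (simp add: powr_def)
      then show ?thesis
        using martingale_tail_le[OF filt mart dom \<phi> int_r r(1,2) _ l n\<^sub>0[OF n(2)], of n]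
          \<delta>(1) n False by (simp add: C_def)
    qed
  qed
qed

end
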